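(* Let $b$ be a prime, let $e=b$, let $s\ge1$, let $p\in\mathrm{GF}(b)[x]$ have degree $e=b$, and let $c_1,\dots,c_s\in\mathrm{GF}(b)$ be such that $p+c_1,\dots,p+c_s$ are pairwise distinct irreducible polynomials of degree $e$. Let $D$ be any invertible diagonal $e\times e$ matrix over $\mathrm{GF}(b)$. For each $i\in\{1,\dots,s\}$ let $M^{(c_i)}$ be the Sobol' matrix of $p+c_i$ with initialization matrix $$M^{(c_i)}_{[e\times e]}=D\,\mathcal{P}^{c_i}_{[e\times e]}\,D^{-1},$$ where $\mathcal{P}^{c}_{[e\times e]}$ is the $c$-th power of the $e\times e$ Pascal matrix, i.e. the $e\times e$ matrix over $\mathrm{GF}(b)$ with $(u,v)$ entry $\binom{v-1}{u-1}c^{v-u}$. Then the $s$-dimensional digital sequence in base $b$ generated by $M^{(c_1)},\dots,M^{(c_s)}$ is a $(0,s)$-sequence in base $b$.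
   Context: All matrices have entries in $\mathrm{GF}(b)=\mathbb{Z}/b\mathbb{Z}$, $b$ prime. Convention: $\binom{v-1}{u-1}c^{v-u}$ is understood to be $0$ when $v<u$, and $c^0=1$ (also for $c=0$). Sobol' matrix (block recurrence). Let $p(x)=\sum_{i=0}^{e}a_ix^i$ be a polynomial of degree $e$ over $\mathrm{GF}(b)$. Let $Q_p$ be the $e\times e$ lower triangular Toeplitz matrix with $(u,v)$ entry $-a_{u-v}$ for $u\ge v$ and $0$ for $u<v$ ($1\le u,v\le e$). Let $F_p$ be the inverse of the $e\times e$ upper unitriangular Toeplitz matrix $F_p^{-1}$ whose $(u,v)$ entry is $1$ if $u=v$, $-a_{e-(v-u)}$ if $v>u$, and $0$ if $v<u$ (so the first row of $F_p^{-1}$ is $1,-a_{e-1},-a_{e-2},\dots,-a_1$). Given an invertible upper triangular $e\times e$ initialization matrix $M_{[e\times e]}$, the Sobol' matrix $M$ of $p$ is the infinite matrix with $e\times e$ blocks $M_{i,j}$, $i,j\ge1$, defined by $M_{i,1}=\delta_{i,1}M_{[e\times e]}$ and $$M_{i,j}=\left(M_{i,j-1}Q_p+M_{i-1,j-1}\right)F_p\qquad (i\ge1,\ j\ge2),$$ with $M_{0,j}=0$. The matrix $M$ is upper triangular with nonzero diagonal entries. For a shifted polynomial $p+c$, $c\in\mathrm{GF}(b)$, its Sobol' matrix is denoted $M^{(c)}$. Digital sequence. Given infinite upper triangular matrices $M_1,\dots,M_s$ over $\mathrm{GF}(b)$, the point $x_n\in[0,1)^s$ ($n\ge0$) is defined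 as follows: write $n=\sum_{k\ge0}n_kb^k$ with digits $n_k\in\{0,\dots,b-1\}$, let $\vec n=(n_0,n_1,\dots)^T$, compute $y^{(i)}=M_i\vec n$ over $\mathrm{GF}(b)$ (a vector with finitely many nonzero entries), and let the $i$-th coordinate of $x_n$ be $\sum_{k\ge1}y^{(i)}_kb^{-k}$, entries being identified with integers in $\{0,\dots,b-1\}$. Nets and sequences. A family of $b^m$ points in $[0,1)^s$ is a $(0,m,s)$-net in base $b$ if for all integers $d_1,\dots,d_s\ge0$ with $\sum_i d_i=m$, every box $\prod_{i=1}^s[A_ib^{-d_i},(A_i+1)b^{-d_i})$ with integers $0\le A_i<b^{d_i}$ contains exactly one of the points. A sequence $(x_n)_{n\ge0}$ in $[0,1)^s$ is a $(0,s)$-sequence in base $b$ if for all integers $k\ge0$, $m\ge 0$, the points $x_n$ with $kb^m\le n<(k+1)b^m$ form a $(0,m,s)$-net in base $b$. For the digital sequence $(x_n)_{n\ge0}$ in base $b$ generated by infinite upper triangular matrices $M_1,\dots,M_s$ over $\mathrm{GF}(b)$, it is standard that the first $b^m$ points form a $(0,m,s)$-net if and only if, for all $d_1,\dots,d_s\ge0$ with $\sum_id_i=m$, the $m\times m$ matrix obtained by stacking the first $d_i$ rows of the top-left $m\times m$ submatrix of $M_i$, $i=1,\dots,s$, is nonsingular; the sequence is a $(0,s)$-sequence if and only if this holds for all $m$. *)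

theory Defs
  imports
    Complex_Main
    "Berlekamp_Zassenhaus.Finite_Field"
    "Jordan_Normal_Form.Gauss_Jordan_Elimination"
    "Jordan_Normal_Form.Determinant"
begin

text \<open>
  GF(b) is the type \<open>'b mod_ring\<close> with \<open>'b :: prime_card\<close> and b = \<open>CARD('b)\<close>.
  Entries of matrices are indexed from 0 here, so the entry in position (u, v) below sits in
  position (u + 1, v + 1) of the usual one-based notation. Likewise the coordinates of an
  s-dimensional point are indexed by 0, ..., s - 1.
\<close>

section \<open>Sobol' matrices\<close>

text \<open>\<open>mat_inverse\<close> returns an option; this is meant for invertible matrices only.\<close>

definition mat_inv :: "'a::field mat \<Rightarrow> 'a mat" where
  "mat_inv A = the (mat_inverse A)"

lemma mat_inv:
  fixes A :: "'a::field mat"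
  assumes A: "A \<in> carrier_mat n n" and "invertible_mat A"
  shows "mat_inv A \<in> carrier_mat n n" "A * mat_inv A = 1\<^sub>m n" "mat_inv A * A = 1\<^sub>m n"
proof -
  from assms obtain B where B: "A * B = 1\<^sub>m n" "B * A = 1\<^sub>m (dim_row B)"
    by (auto simp: invertible_mat_def inverts_mat_def)
  have dB: "dim_row B = n"
    using arg_cong[OF B(2), of dim_col] A by simp
  have cB: "dim_col B = n"
    using arg_cong[OF B(1), of dim_col] by simp
  have "A \<in> Units (ring_mat TYPE('a) n ())"
    using A B dB cB by (auto simp: Units_def ring_mat_def)
  then obtain C where C: "mat_inverse A = Some C"
    using mat_inverse(1)[OF A, of "()"] by (cases "mat_inverse A") auto
  show "mat_inv A \<in> carrier_mat n n" "A * mat_inv A = 1\<^sub>m n" "mat_inv A * A = 1\<^sub>m n"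
    using mat_inverse(2)[OF A C] C by (auto simp: mat_inv_def)
qed

definition Q_mat :: "'a::field poly \<Rightarrow> 'a mat" where
  "Q_mat p = mat (degree p) (degree p) (\<lambda>(u, v). if v \<le> u then - coeff p (u - v) else 0)"

definition F_inv_mat :: "'a::field poly \<Rightarrow> 'a mat" where
  "F_inv_mat p = mat (degree p) (degree p)
     (\<lambda>(u, v). if u = v then 1 else if u < v then - coeff p (degree p - (v - u)) else 0)"

definition F_mat :: "'a::field poly \<Rightarrow> 'a mat" where
  "F_mat p = mat_inv (F_inv_mat p)"

lemma invertible_F_inv_mat: "invertible_mat (F_inv_mat p)"
proof -
  let ?n = "degree p"
  have carr: "F_inv_mat p \<in> carrier_mat ?n ?n"
    by (simp add: F_inv_mat_def)
  have "upper_triangular (F_inv_mat p)"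
    by (auto simp: F_inv_mat_def)
  then have "det (F_inv_mat p) = prod_list (diag_mat (F_inv_mat p))"
    using carr by (rule det_upper_triangular)
  also have "diag_mat (F_inv_mat p) = map (\<lambda>_. 1) [0..<?n]"
    by (auto simp: diag_mat_def F_inv_mat_def)
  also have "prod_list (map (\<lambda>_. 1) [0..<?n]) = (1 :: 'a)"
    by (induction ?n) (auto simp: map_replicate_const)
  finally have "F_inv_mat p \<in> Units (ring_mat TYPE('a) ?n ())"
    by (intro det_non_zero_imp_unit[OF carr]) simp
  then show ?thesis
    using carr by (auto simp: Units_def ring_mat_def invertible_mat_def inverts_mat_def)
qed

lemmas F_mat = mat_inv[of "F_inv_mat p" "degree p" for p,
    OF _ invertible_F_inv_mat, folded F_mat_def]

text \<open>
  The blocks \<open>M\<^bsub>i,j\<^esub>\<close> carry indices i, j \<open>\<ge>\<close> 1, with \<open>M\<^bsub>0,j\<^esub>\<close> = 0.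
  The value for j = 0 is a dummy that is never used.
\<close>

fun sobol_block :: "'a::field poly \<Rightarrow> 'a mat \<Rightarrow> nat \<Rightarrow> nat \<Rightarrow> 'a mat" where
  "sobol_block p M0 i 0 = 0\<^sub>m (degree p) (degree p)"
| "sobol_block p M0 i (Suc 0) = (if i = 1 then M0 else 0\<^sub>m (degree p) (degree p))"
| "sobol_block p M0 0 (Suc (Suc j)) = 0\<^sub>m (degree p) (degree p)"
| "sobol_block p M0 (Suc i) (Suc (Suc j)) =
     (sobol_block p M0 (Suc i) (Suc j) * Q_mat p + sobol_block p M0 i (Suc j)) * F_mat p"

definition sobol_matrix :: "'a::field poly \<Rightarrow> 'a mat \<Rightarrow> nat \<Rightarrow> nat \<Rightarrow> 'a" where
  "sobol_matrix p M0 r k =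
     (let e = degree p
      in sobol_block p M0 (r div e + 1) (k div e + 1) $$ (r mod e, k mod e))"

text \<open>
  With these indices the convention for v < u needs no case distinction,
  since then \<open>v choose u\<close> = 0.
\<close>

definition pascal_power :: "nat \<Rightarrow> 'a::field \<Rightarrow> 'a mat" where
  "pascal_power e c = mat e e (\<lambda>(u, v). of_nat (v choose u) * c ^ (v - u))"

lemma pascal_power_add:
  "pascal_power e (a + c) = pascal_power e a * pascal_power e (c :: 'a::field)"
proof (rule eq_matI)
  fix u v assume "u < dim_row (pascal_power e a * pascal_power e c)"
    and "v < dim_col (pascal_power e a * pascal_power e c)"
  then have uv: "u < e" "v < e" by (simp_all add: pascal_power_def)
  let ?f = "\<lambda>w. of_nat (w choose u) * a ^ (w - u) * (of_nat (v choose w) * c ^ (v - w))"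
  have "(pascal_power e a * pascal_power e c) $$ (u, v) = (\<Sum>w<e. ?f w)"
    using uv by (simp add: pascal_power_def scalar_prod_def atLeast0LessThan)
  also have "\<dots> = pascal_power e (a + c) $$ (u, v)"
  proof (cases "u \<le> v")
    case True
    have "(\<Sum>w<e. ?f w) = (\<Sum>w=u..v. ?f w)"
    proof (rule sum.mono_neutral_right)
      show "\<forall>w\<in>{..<e} - {u..v}. ?f w = 0"
      proof
        fix w assume "w \<in> {..<e} - {u..v}"
        then have "w < u \<or> v < w" by auto
        then show "?f w = 0" by (auto simp: binomial_eq_0)
      qed
    qed (use uv in auto)
    also have "\<dots> = (\<Sum>t\<le>v - u. ?f (u + t))"
      using True by (intro sum.reindex_bij_witness[of _ "\<lambda>t. u + t" "\<lambda>w. w - u"]) auto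
    also have "\<dots> = (\<Sum>t\<le>v - u. of_nat (v choose u) *
        (of_nat (v - u choose t) * a ^ t * c ^ (v - u - t)))"
    proof (rule sum.cong[OF refl])
      fix t assume "t \<in> {..v - u}"
      then have "(v choose (u + t)) * ((u + t) choose u) = (v choose u) * ((v - u) choose t)"
        using choose_mult[of u "u + t" v] True by simp
      then have eq: "of_nat (v choose (u + t)) * of_nat ((u + t) choose u) =
          (of_nat (v choose u) * of_nat (v - u choose t) :: 'a)"
        by (simp flip: of_nat_mult)
      have "?f (u + t) = (of_nat (v choose (u + t)) * of_nat ((u + t) choose u)) *
          (a ^ t * c ^ (v - u - t))"
        by (simp add: mult_ac)
      then show "?f (u + t) = of_nat (v choose u) *
          (of_nat (v - u choose t) * a ^ t * c ^ (v - u - t))"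
        unfolding eq by (simp only: mult.assoc)
    qed
    also have "\<dots> = of_nat (v choose u) * (a + c) ^ (v - u)"
      by (simp add: binomial_ring sum_distrib_left)
    finally show ?thesis using uv by (simp add: pascal_power_def)
  next
    case False
    have "?f w = 0" for w
      using False by (cases "w < u") (auto simp: binomial_eq_0)
    then have "(\<Sum>w<e. ?f w) = 0"
      by (intro sum.neutral) blast
    then show ?thesis using uv False by (simp add: pascal_power_def binomial_eq_0)
  qed
  finally show "pascal_power e (a + c) $$ (u, v) =
      (pascal_power e a * pascal_power e c) $$ (u, v)" by simp
qed (simp_all add: pascal_power_def)

lemma pascal_power_of_nat: "pascal_power e (of_nat k :: 'a::field) = pascal_power e 1 ^\<^sub>m k"
proof (induction k)
  case 0
  have "of_nat (v choose u) * 0 ^ (v - u) = (if u = v then 1 else 0 :: 'a)" for u v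
    by (cases u v rule: linorder_cases) (auto simp: binomial_eq_0 power_0_left)
  then show ?case by (intro eq_matI) (auto simp: pascal_power_def)
next
  case (Suc k)
  then show ?case
    using pascal_power_add[of e "of_nat k :: 'a" 1] by (simp add: add.commute)
qed


section \<open>Digital sequences\<close>

definition digit :: "nat \<Rightarrow> nat \<Rightarrow> nat \<Rightarrow> nat" where
  "digit b n r = n div b ^ r mod b"

lemma finite_digit_support:
  assumes "b \<ge> 2"
  shows "finite {r. digit b n r \<noteq> 0}"
proof (rule finite_subset)
  show "{r. digit b n r \<noteq> 0} \<subseteq> {..n}"
  proof (rule subsetI, rule ccontr)
    fix r assume r: "r \<in> {r. digit b n r \<noteq> 0}" "r \<notin> {..n}"
    have "r < 2 ^ r" by (rule less_exp)
    also have "(2::nat) ^ r \<le> b ^ r" using assms by (rule power_mono) simp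
    finally have "n < b ^ r" using r(2) by simp
    then show False using r(1) by (simp add: digit_def)
  qed
qed simp

definition digit_image ::
    "(nat \<Rightarrow> nat \<Rightarrow> 'b::prime_card mod_ring) \<Rightarrow> nat \<Rightarrow> nat \<Rightarrow> 'b mod_ring" where
  "digit_image M n k =
     (\<Sum>r | digit CARD('b) n r \<noteq> 0. M k r * of_nat (digit CARD('b) n r))"

text \<open>Coordinate i of the point number n of the digital sequence generated by the matrices M i.\<close>

definition digital_sequence ::
    "(nat \<Rightarrow> nat \<Rightarrow> nat \<Rightarrow> 'b::prime_card mod_ring) \<Rightarrow> nat \<Rightarrow> nat \<Rightarrow> real" where
  "digital_sequence M n i =
     (\<Sum>k. real_of_int (to_int_mod_ring (digit_image (M i) n k)) / real CARD('b) ^ (k + 1))"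


section \<open>Nets and sequences\<close>

definition unit_cube :: "nat \<Rightarrow> (nat \<Rightarrow> real) set" where
  "unit_cube s = {z. \<forall>i<s. 0 \<le> z i \<and> z i < 1}"

definition elementary_box ::
    "nat \<Rightarrow> nat \<Rightarrow> (nat \<Rightarrow> nat) \<Rightarrow> (nat \<Rightarrow> nat) \<Rightarrow> (nat \<Rightarrow> real) set" where
  "elementary_box b s d A =
     {z. \<forall>i<s. real (A i) / real b ^ d i \<le> z i \<and> z i < real (A i + 1) / real b ^ d i}"

text \<open>
  A family of points is given by an index set I and a map x on it, so that points are counted
  with multiplicity.
\<close>

definition is_0ms_net ::
    "nat \<Rightarrow> nat \<Rightarrow> nat \<Rightarrow> nat set \<Rightarrow> (nat \<Rightarrow> nat \<Rightarrow> real) \<Rightarrow> bool" where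
  "is_0ms_net b m s I x \<longleftrightarrow>
     finite I \<and> card I = b ^ m \<and> (\<forall>n\<in>I. x n \<in> unit_cube s) \<and>
     (\<forall>d A. (\<Sum>i<s. d i) = m \<longrightarrow> (\<forall>i<s. A i < b ^ d i) \<longrightarrow>
        (\<exists>!n. n \<in> I \<and> x n \<in> elementary_box b s d A))"

definition is_0s_sequence :: "nat \<Rightarrow> nat \<Rightarrow> (nat \<Rightarrow> nat \<Rightarrow> real) \<Rightarrow> bool" where
  "is_0s_sequence b s x \<longleftrightarrow>
     (\<forall>n. x n \<in> unit_cube s) \<and>
     (\<forall>k m. is_0ms_net b m s {k * b ^ m..<(k + 1) * b ^ m} x)"

end

theory Submission
  imports Defs
begin

text \<open>
  With \<open>M\<^sub>j(t) = \<Sum>\<^sub>i M\<^bsub>i,j\<^esub> t\<^bsup>i-1\<^esup>\<close> the block recurrence reads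
  \<open>M\<^sub>j(t) = M\<^sub>1 ((Q\<^sub>p + t) F\<^sub>p)\<^bsup>j-1\<^esup>\<close>. Passing from p to p + c leaves \<open>F\<^sub>p\<close> unchanged
  and replaces \<open>Q\<^sub>p\<close> by \<open>Q\<^sub>p - c\<close>, that is, t by t - c. Hence the Sobol' matrix of p + c is
  the Kronecker product of the (-c)-th power of the infinite Pascal matrix with the
  initialization matrix, times the Sobol' matrix N of p with identity initialization, and N does
  not depend on c. As e = b, Lucas' theorem together with \<open>c\<^sup>b = c\<close> identifies this Kronecker
  product with the c-th power of the infinite Pascal matrix up to conjugation by a diagonal matrix
  (D on the blocks, with alternating signs absorbing the change from -c to c).

  Since N is upper unitriangular, a vector annihilated by the first \<open>d\<^sub>i\<close> rows of all the
  matrices yields a polynomial f of degree less than \<open>m = \<Sum>\<^sub>i d\<^sub>i\<close> such that the coefficients of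
  \<open>f(x + c\<^sub>i)\<close> of order less than \<open>d\<^sub>i\<close> vanish for every i. Then \<open>c\<^sub>i\<close> is a root of
  multiplicity at least \<open>d\<^sub>i\<close>, so f = 0.
\<close>

section \<open>Pascal matrices and Hermite interpolation\<close>

text \<open>This is (1 + x)^(b+n) = (1 + x^b) (1 + x)^n in characteristic b: in Vandermonde's
  convolution the prime b divides every b choose j except those with j = 0 and j = b.\<close>

lemma of_nat_choose_add_CHAR:
  assumes "prime CHAR('a::comm_semiring_1)"
  shows "of_nat ((CHAR('a) + n) choose k) =
    (of_nat (n choose k) + (if CHAR('a) \<le> k then of_nat (n choose (k - CHAR('a))) else 0) :: 'a)"
proof -
  let ?b = "CHAR('a)"
  let ?f = "\<lambda>j. of_nat (?b choose j) * of_nat (n choose (k - j)) :: 'a"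
  have b: "?b > 0" using assms prime_gt_0_nat by blast
  have "of_nat ((?b + n) choose k) = (\<Sum>j\<le>k. ?f j)"
    by (simp flip: vandermonde)
  also have "\<dots> = (\<Sum>j\<in>{0, ?b} \<inter> {..k}. ?f j)"
  proof (rule sum.mono_neutral_right)
    show "\<forall>j\<in>{..k} - {0, ?b} \<inter> {..k}. ?f j = 0"
    proof
      fix j assume "j \<in> {..k} - {0, ?b} \<inter> {..k}"
      then have j: "j \<noteq> 0" "j \<noteq> ?b" by auto
      have "?b dvd (?b choose j)"
      proof (cases "j < ?b")
        case True
        then show ?thesis using dvd_choose_prime[OF _ _ _ assms] j by auto
      next
        case False
        then show ?thesis using j by (simp add: binomial_eq_0)
      qed
      then have "of_nat (?b choose j) = (0 :: 'a)"
        using of_nat_eq_0_iff_char_dvd by blast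
      then show "?f j = 0" by simp
    qed
  qed auto
  also have "\<dots> = of_nat (n choose k) + (if ?b \<le> k then of_nat (n choose (k - ?b)) else 0)"
    using b by (auto simp: Int_insert_left)
  finally show ?thesis .
qed

text \<open>One digit step of Lucas' theorem, with \<open>l\<close> and \<open>i\<close> arbitrary.
  Adding b to the upper argument acts on the pair (\<open>l\<close>, \<open>i\<close>) like Pascal's
  rule, so induction on \<open>l\<close> suffices.\<close>

lemma lucas_choose:
  assumes "prime CHAR('a::comm_semiring_1)" and "u < CHAR('a)" and "w < CHAR('a)"
  shows "of_nat ((CHAR('a) * l + w) choose (CHAR('a) * i + u)) =
    (of_nat (l choose i) * of_nat (w choose u) :: 'a)"
proof (induction l arbitrary: i)
  case 0
  have "w choose (CHAR('a) * i + u) = 0" if "i > 0" for i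
  proof -
    have "CHAR('a) * 1 \<le> CHAR('a) * i" using that by (intro mult_le_mono) auto
    then show ?thesis using assms by (intro binomial_eq_0) linarith
  qed
  then show ?case by (cases "i = 0") (auto simp: binomial_eq_0)
next
  case (Suc l)
  have "(CHAR('a) * Suc l + w) choose (CHAR('a) * i + u) =
      (CHAR('a) + (CHAR('a) * l + w)) choose (CHAR('a) * i + u)"
    by (simp add: algebra_simps)
  then have *: "of_nat ((CHAR('a) * Suc l + w) choose (CHAR('a) * i + u)) =
      (of_nat ((CHAR('a) * l + w) choose (CHAR('a) * i + u)) +
       (if CHAR('a) \<le> CHAR('a) * i + u
        then of_nat ((CHAR('a) * l + w) choose (CHAR('a) * i + u - CHAR('a))) else 0) :: 'a)"
    by (simp only: of_nat_choose_add_CHAR[OF assms(1)])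
  show ?case
  proof (cases i)
    case 0
    then show ?thesis using Suc[of 0] assms(2) unfolding * by simp
  next
    case (Suc i')
    then have "CHAR('a) \<le> CHAR('a) * i + u" "CHAR('a) * i + u - CHAR('a) = CHAR('a) * i' + u"
      by simp_all
    then show ?thesis
      unfolding * using Suc.IH[of i] Suc.IH[of i'] \<open>i = Suc i'\<close> by (simp add: algebra_simps)
  qed
qed

text \<open>The coefficient of x^i in (x + c)^k, that is, the entry in row \<open>i\<close> and
  column \<open>k\<close> of the c-th power of the infinite Pascal matrix; the column index comes
  first.\<close>

definition shift_coeff :: "'a::comm_semiring_1 \<Rightarrow> nat \<Rightarrow> nat \<Rightarrow> 'a" where
  "shift_coeff c k i = of_nat (k choose i) * c ^ (k - i)"

text \<open>Multiplication of (x + c)^k by x + c. Besides identifying the coefficients of powers,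
  this recurrence is the one that matches the block recurrence in
  \<open>sobol_block_shift\<close>.\<close>

lemma shift_coeff_Suc:
  "shift_coeff c (Suc k) i = (case i of 0 \<Rightarrow> 0 | Suc i' \<Rightarrow> shift_coeff c k i') + c * shift_coeff c k i"
proof (cases i)
  case (Suc i')
  have "c * (of_nat (k choose i) * c ^ (k - i)) = of_nat (k choose i) * c ^ (k - i')"
  proof (cases "i \<le> k")
    case True
    then have "k - i' = Suc (k - i)" using Suc by simp
    then show ?thesis by (simp add: mult_ac)
  qed (simp add: binomial_eq_0)
  then show ?thesis using Suc by (simp add: shift_coeff_def algebra_simps)
qed (simp add: shift_coeff_def)

lemma coeff_linear_power: "coeff ([:c, 1:] ^ n) k = shift_coeff c n k"
proof (induction n arbitrary: k)
  case 0
  then show ?case by (cases k) (simp_all add: shift_coeff_def)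
next
  case (Suc n)
  have "[:c, 1:] ^ Suc n = smult c ([:c, 1:] ^ n) + pCons 0 ([:c, 1:] ^ n)"
    by simp
  then have "coeff ([:c, 1:] ^ Suc n) k =
      c * coeff ([:c, 1:] ^ n) k + coeff (pCons 0 ([:c, 1:] ^ n)) k"
    by simp
  then show ?case by (cases k) (simp_all add: Suc shift_coeff_Suc add.commute)
qed

text \<open>The binomials factor by Lucas, and c^b = c turns c^(b l') into c^l'. Outside
  \<open>i\<close> <= \<open>l\<close> and \<open>u\<close> <= \<open>w\<close> the truncated
  exponents do not add up, but both sides vanish there.\<close>

lemma shift_coeff_lucas:
  fixes c :: "'b::prime_card mod_ring"
  assumes "u < CARD('b)" and "w < CARD('b)"
  shows "shift_coeff c (CARD('b) * l + w) (CARD('b) * i + u) = shift_coeff c l i * shift_coeff c w u"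
proof (cases "i \<le> l \<and> u \<le> w")
  case True
  then obtain l' w' where lw: "l = i + l'" "w = u + w'" by (auto simp: le_iff_add)
  have "c ^ CARD('b) = c" using finite_field_power_card_eq_same[of c] by simp
  then have "c ^ (CARD('b) * l') = c ^ l'" by (simp add: power_mult)
  then have "c ^ (CARD('b) * l + w - (CARD('b) * i + u)) = c ^ (l - i) * c ^ (w - u)"
    by (simp add: lw power_add algebra_simps)
  then show ?thesis
    using lucas_choose[of u w l i, where 'a = "'b mod_ring"] assms prime_card[where 'a = 'b]
    by (simp add: shift_coeff_def mult_ac)
next
  case False
  then show ?thesis
    using lucas_choose[of u w l i, where 'a = "'b mod_ring"] assms prime_card[where 'a = 'b]
    by (auto simp: shift_coeff_def binomial_eq_0)
qed

text \<open>Writing (-1)^(k-i) as (-1)^i (-1)^k exhibits the change of sign as conjugation by an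
  alternating diagonal matrix.\<close>

lemma shift_coeff_uminus:
  fixes c :: "'a::comm_ring_1"
  shows "shift_coeff (- c) k i = (- 1) ^ i * (- 1) ^ k * shift_coeff c k i"
proof (cases "i \<le> k")
  case True
  then obtain k' where "k = i + k'" by (auto simp: le_iff_add)
  moreover have "(- c) ^ k' = (- 1) ^ k' * c ^ k'" by (rule power_minus)
  ultimately show ?thesis
    by (simp add: shift_coeff_def power_add mult.assoc mult.left_commute[of _ "(- 1) ^ k'"])
qed (simp add: shift_coeff_def binomial_eq_0)

section \<open>Taylor shifts of polynomials and Hermite interpolation\<close>

lemma coeff_pcompose_shift:
  fixes c :: "'a::comm_ring_1"
  assumes "\<And>l. l \<ge> n \<Longrightarrow> coeff f l = 0"
  shows "coeff (f \<circ>\<^sub>p [:c, 1:]) k = (\<Sum>l<n. shift_coeff c l k * coeff f l)"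
proof -
  have "f = (\<Sum>l<n. monom (coeff f l) l)"
    by (rule poly_eqI) (use assms in \<open>auto simp: coeff_sum sum.delta not_less\<close>)
  then have "f \<circ>\<^sub>p [:c, 1:] = (\<Sum>l<n. monom (coeff f l) l) \<circ>\<^sub>p [:c, 1:]" by simp
  also have "\<dots> = (\<Sum>l<n. smult (coeff f l) ([:c, 1:] ^ l))"
    by (simp add: pcompose_hom.hom_sum monom_altdef pcompose_smult pcompose_hom.hom_power
        pcompose_pCons)
  finally have "coeff (f \<circ>\<^sub>p [:c, 1:]) k = coeff (\<Sum>l<n. smult (coeff f l) ([:c, 1:] ^ l)) k" by simp
  then show ?thesis by (simp add: coeff_sum coeff_linear_power mult_ac)
qed

text \<open>Substituting x - c undoes the shift and carries the divisor x^d of f(x + c) to the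
  divisor (x - c)^d of f.\<close>

lemma linear_power_dvd_of_pcompose_shift:
  fixes c :: "'a::comm_ring_1"
  assumes "\<And>k. k < d \<Longrightarrow> coeff (f \<circ>\<^sub>p [:c, 1:]) k = 0"
  shows "[:- c, 1:] ^ d dvd f"
proof -
  have "monom 1 d dvd f \<circ>\<^sub>p [:c, 1:]" using assms by (simp add: monom_1_dvd_iff')
  then obtain g where "f \<circ>\<^sub>p [:c, 1:] = monom 1 d * g" by (auto elim: dvdE)
  then have "(f \<circ>\<^sub>p [:c, 1:]) \<circ>\<^sub>p [:- c, 1:] = (monom 1 d * g) \<circ>\<^sub>p [:- c, 1:]" by simp
  moreover have "(f \<circ>\<^sub>p [:c, 1:]) \<circ>\<^sub>p [:- c, 1:] = f"
    by (simp add: pcompose_pCons pcompose_idR flip: pcompose_assoc)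
  ultimately have "f = [:- c, 1:] ^ d * (g \<circ>\<^sub>p [:- c, 1:])"
    by (simp add: pcompose_mult monom_altdef pcompose_hom.hom_power pcompose_pCons)
  then show ?thesis by (metis dvd_triv_left)
qed

text \<open>A nonzero f has at most \<open>degree f\<close> roots counted with multiplicity.
  Bounding the coefficients instead of the degree lets the case of total multiplicity 0 be
  included.\<close>

lemma hermite_interpolation_unique:
  fixes c :: "'i \<Rightarrow> 'a::idom"
  assumes "finite S" and "inj_on c S"
    and deg: "\<And>l. l \<ge> (\<Sum>i\<in>S. d i) \<Longrightarrow> coeff f l = 0"
    and zero: "\<And>i k. i \<in> S \<Longrightarrow> k < d i \<Longrightarrow> coeff (f \<circ>\<^sub>p [:c i, 1:]) k = 0"
  shows "f = 0"
proof (rule ccontr)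
  assume f: "f \<noteq> 0"
  have ord: "d i \<le> order (c i) f" if "i \<in> S" for i
    using order_divides[of "c i" "d i" f] linear_power_dvd_of_pcompose_shift[OF zero[OF that]] f
    by blast
  let ?R = "{x. poly f x = 0}"
  have fin: "finite ?R" using f by (simp add: poly_roots_finite)
  have "(\<Sum>i\<in>S. d i) \<le> (\<Sum>i\<in>S. order (c i) f)" by (intro sum_mono ord)
  also have "\<dots> = (\<Sum>x\<in>c ` S. order x f)" using assms(2) by (simp add: sum.reindex)
  also have "\<dots> = (\<Sum>x\<in>c ` S \<inter> ?R. order x f)"
    using assms(1) by (intro sum.mono_neutral_right) (auto simp: order_root)
  also have "\<dots> \<le> (\<Sum>x\<in>?R. order x f)" by (intro sum_mono2 fin) auto
  also have "\<dots> \<le> degree f" by (rule sum_order_le_degree[OF f])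
  finally have "coeff f (degree f) = 0" by (rule deg)
  then show False using f by simp
qed

section \<open>Digital sequences generated by upper triangular matrices\<close>

lemma digit_less: "b > 0 \<Longrightarrow> digit b n r < b"
  by (simp add: digit_def)

lemma digit_eq_0:
  assumes "b \<ge> 2" and "n \<le> r"
  shows "digit b n r = 0"
proof -
  have "r < 2 ^ r" by (rule less_exp)
  also have "(2::nat) ^ r \<le> b ^ r" using assms by (intro power_mono) auto
  finally show ?thesis using assms by (simp add: digit_def)
qed

lemma digit_eq_of_div_eq:
  assumes "n div b ^ m = n' div b ^ m" and "m \<le> r"
  shows "digit b n r = digit b n' r"
proof -
  have "b ^ r = b ^ m * b ^ (r - m)" using assms(2) by (simp flip: power_add)
  then show ?thesis using assms(1) by (simp add: digit_def div_mult2_eq)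
qed

lemma mod_power_eq_of_digit_eq:
  assumes "\<And>r. r < m \<Longrightarrow> digit b n r = digit b n' r"
  shows "n mod b ^ m = n' mod b ^ m"
  using assms
proof (induction m)
  case (Suc m)
  have "n mod b ^ Suc m = b ^ m * digit b n m + n mod b ^ m" for n
    unfolding power_Suc2 mod_mult2_eq digit_def ..
  then show ?case using Suc by simp
qed simp

text \<open>The integer with base-b digits \<open>a 0\<close>, ..., \<open>a (d - 1)\<close>, most
  significant first. It numbers the elementary interval of length b^(-d) that contains 0.a0 a1 a2
  ...\<close>

fun radix_prefix :: "nat \<Rightarrow> (nat \<Rightarrow> nat) \<Rightarrow> nat \<Rightarrow> nat" where
  "radix_prefix b a 0 = 0"
| "radix_prefix b a (Suc d) = b * radix_prefix b a d + a d"

lemma radix_prefix_less: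
  assumes "\<And>k. a k < b"
  shows "radix_prefix b a d < b ^ d"
proof (induction d)
  case (Suc d)
  have "b * radix_prefix b a d + a d < b * (radix_prefix b a d + 1)" using assms[of d] by simp
  also have "\<dots> \<le> b * b ^ d" using Suc by (intro mult_le_mono) auto
  finally show ?case by simp
qed simp

lemma radix_prefix_inj:
  assumes "\<And>k. a k < b" and "\<And>k. a' k < b"
    and "radix_prefix b a d = radix_prefix b a' d" and "k < d"
  shows "a k = a' k"
  using assms(3,4)
proof (induction d)
  case (Suc d)
  have "(b * radix_prefix b a d + a d) mod b = (b * radix_prefix b a' d + a' d) mod b"
    "(b * radix_prefix b a d + a d) div b = (b * radix_prefix b a' d + a' d) div b"
    using Suc.prems(1) by simp_all
  then have "a d = a' d" "radix_prefix b a d = radix_prefix b a' d"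
    using assms(1,2)[of d] by simp_all
  then show ?case using Suc by (cases "k = d") auto
qed simp

lemma sum_radix_prefix:
  assumes "b > 0"
  shows "(\<Sum>k<d. real (a k) / real b ^ (k + 1)) = real (radix_prefix b a d) / real b ^ d"
  by (induction d) (use assms in \<open>auto simp: field_simps\<close>)

text \<open>Finite support makes the upper bound strict: an infinite tail of digits b - 1 would
  reach the right endpoint of the interval.\<close>

lemma radix_value_bounds:
  assumes b: "b > 0" and a: "\<And>k. a k < b" and supp: "\<And>k. k \<ge> K \<Longrightarrow> a k = 0"
  defines "x \<equiv> (\<Sum>k. real (a k) / real b ^ (k + 1))"
  shows "real (radix_prefix b a d) / real b ^ d \<le> x"
    and "x < real (radix_prefix b a d + 1) / real b ^ d"
proof -
  \<comment> \<open>This length covers both the prefix and the support of the digits.\<close>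
  let ?n = "d + K"
  have x: "x = (\<Sum>k<?n. real (a k) / real b ^ (k + 1))"
    unfolding x_def using supp by (intro suminf_finite) auto
  have "(\<Sum>k<d. real (a k) / real b ^ (k + 1)) \<le> x"
    unfolding x by (intro sum_mono2) auto
  then show "real (radix_prefix b a d) / real b ^ d \<le> x"
    by (simp only: sum_radix_prefix[OF b])
  have "radix_prefix b a (d + j) < (radix_prefix b a d + 1) * b ^ j" for j
  proof (induction j)
    case (Suc j)
    have "radix_prefix b a (d + Suc j) < b * (radix_prefix b a (d + j) + 1)"
      using a[of "d + j"] by simp
    also have "\<dots> \<le> b * ((radix_prefix b a d + 1) * b ^ j)"
      using Suc by (intro mult_le_mono) auto
    finally show ?case by (simp add: algebra_simps)
  qed simp
  from this[of K] have "real (radix_prefix b a ?n) < real (radix_prefix b a d + 1) * real b ^ K"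
    by (simp only: flip: of_nat_power of_nat_mult of_nat_less_iff)
  then have "real (radix_prefix b a ?n) / real b ^ ?n < real (radix_prefix b a d + 1) / real b ^ d"
    using b by (simp add: field_simps power_add)
  then show "x < real (radix_prefix b a d + 1) / real b ^ d"
    unfolding x by (simp only: sum_radix_prefix[OF b])
qed

section \<open>From nonsingular stacked matrices to nets\<close>

lemma of_nat_mod_ring_inj:
  assumes "(of_nat i :: 'b::prime_card mod_ring) = of_nat j" and "i < CARD('b)" and "j < CARD('b)"
  shows "i = j"
  using assms by (simp add: of_nat_eq_iff_cong_CHAR cong_def)

lemma CARD_prime_card_ge_2: "CARD('b::prime_card) \<ge> 2"
  using prime_ge_2_nat[OF prime_card] .

lemma digit_image_eq_sum:
  fixes M :: "nat \<Rightarrow> nat \<Rightarrow> 'b::prime_card mod_ring"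
  assumes "n \<le> L"
  shows "digit_image M n k = (\<Sum>r<L. M k r * of_nat (digit CARD('b) n r))"
proof -
  have "{r. digit CARD('b) n r \<noteq> 0} \<subseteq> {..<L}"
    using digit_eq_0[OF CARD_prime_card_ge_2] assms
    by (metis (mono_tags, lifting) lessThan_iff linorder_not_le mem_Collect_eq order_trans subsetI)
  then show ?thesis
    unfolding digit_image_def by (intro sum.mono_neutral_left) auto
qed

text \<open>The condition \<open>regular\<close> expresses nonsingularity of the stacked matrices as
  a trivial kernel. It handles every block of b^m indices, not only the first: within a block the
  digits from position m on are constant, so they cancel in differences.\<close>

lemma digital_sequence_is_0s_sequence:
  fixes M :: "nat \<Rightarrow> nat \<Rightarrow> nat \<Rightarrow> 'b::prime_card mod_ring"
  assumes upper: "\<And>i k r. i < s \<Longrightarrow> r < k \<Longrightarrow> M i k r = 0"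
    and regular: "\<And>d m w. (\<Sum>i<s. d i) = m \<Longrightarrow>
      (\<And>i k. i < s \<Longrightarrow> k < d i \<Longrightarrow> (\<Sum>r<m. M i k r * w r) = 0) \<Longrightarrow> (\<And>r. r < m \<Longrightarrow> w r = 0)"
  shows "is_0s_sequence CARD('b) s (digital_sequence M)"
proof -
  let ?b = "CARD('b)"
  have b: "?b \<ge> 2" "?b > 0" using CARD_prime_card_ge_2 by auto
  define a where "a n i k = nat (to_int_mod_ring (digit_image (M i) n k))" for n i k
  have to_int: "0 \<le> to_int_mod_ring y" "to_int_mod_ring y < int ?b" for y :: "'b mod_ring"
    using range_to_int_mod_ring[where 'a = 'b] by (auto dest: equalityD1)
  have a_less: "a n i k < ?b" for n i k
    using to_int[of "digit_image (M i) n k"] unfolding a_def by linarith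
  have a_inj: "digit_image (M i) n k = digit_image (M i) n' k" if "a n i k = a n' i k" for n n' i k
    using that to_int unfolding a_def by (metis eq_nat_nat_iff to_int_mod_ring_hom.eq_iff)
  \<comment> \<open>Since n < b^n, all digits of \<open>n\<close> from position \<open>n\<close> on
    vanish, and row \<open>k\<close> of an upper triangular matrix vanishes at the remaining
    positions r < n <= k.\<close>
  have a_supp: "a n i k = 0" if "n \<le> k" "i < s" for n i k
  proof -
    have "M i k r * of_nat (digit ?b n r) = 0" if "r < n" for r
      using upper[OF \<open>i < s\<close>, of r k] \<open>n \<le> k\<close> that by simp
    then have "digit_image (M i) n k = 0"
      unfolding digit_image_eq_sum[OF order_refl] by (intro sum.neutral) blast
    then show ?thesis by (simp add: a_def)
  qed
  have seq: "digital_sequence M n i = (\<Sum>k. real (a n i k) / real ?b ^ (k + 1))" for n i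
    unfolding digital_sequence_def a_def using to_int by simp
  have bounds: "real (radix_prefix ?b (a n i) d) / real ?b ^ d \<le> digital_sequence M n i"
    "digital_sequence M n i < real (radix_prefix ?b (a n i) d + 1) / real ?b ^ d"
    if "i < s" for n i d
    using radix_value_bounds[of ?b "a n i" n d, OF b(2) a_less a_supp[OF _ that]]
    by (simp_all only: seq)
  \<comment> \<open>For the empty prefix the elementary interval is [0, 1).\<close>
  have cube: "digital_sequence M n \<in> unit_cube s" for n
    unfolding unit_cube_def using bounds[where d = 0] by simp
  have net: "is_0ms_net ?b m s {K * ?b ^ m..<(K + 1) * ?b ^ m} (digital_sequence M)" for K m
    unfolding is_0ms_net_def
  proof (intro conjI allI impI ballI cube)
    let ?I = "{K * ?b ^ m..<(K + 1) * ?b ^ m}"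
    show "finite ?I" by simp
    show card_I: "card ?I = ?b ^ m" by (simp add: algebra_simps)
    fix d A :: "nat \<Rightarrow> nat"
    assume d: "(\<Sum>i<s. d i) = m" and A: "\<forall>i<s. A i < ?b ^ d i"
    \<comment> \<open>The label of the box of shape \<open>d\<close> that contains point
      \<open>n\<close>, kept extensional so that the labels form the finite product
      \<open>?T\<close>. The net property becomes bijectivity of \<open>g\<close> from
      \<open>?I\<close> to \<open>?T\<close>.\<close>
    define g where "g n = (\<lambda>i\<in>{..<s}. radix_prefix ?b (a n i) (d i))" for n
    let ?T = "\<Pi>\<^sub>E i\<in>{..<s}. {..<?b ^ d i}"
    have box: "digital_sequence M n \<in> elementary_box ?b s d A \<longleftrightarrow> g n = restrict A {..<s}" for n
    proof -
      have "real (A i) / real ?b ^ d i \<le> digital_sequence M n i \<and>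
          digital_sequence M n i < real (A i + 1) / real ?b ^ d i \<longleftrightarrow>
          radix_prefix ?b (a n i) (d i) = A i" (is "?L \<longleftrightarrow> ?R") if "i < s" for i
      proof
        assume ?L
        then have "real (A i) / real ?b ^ d i < real (radix_prefix ?b (a n i) (d i) + 1) / real ?b ^ d i"
          "real (radix_prefix ?b (a n i) (d i)) / real ?b ^ d i < real (A i + 1) / real ?b ^ d i"
          using bounds[OF that, of n "d i"] by linarith+
        then have "A i < radix_prefix ?b (a n i) (d i) + 1" "radix_prefix ?b (a n i) (d i) < A i + 1"
          using b(2) by (simp_all only: divide_less_cancel of_nat_less_iff) auto
        then show ?R by simp
      next
        assume ?R
        then show ?L using bounds[OF that, of n "d i"] by simp
      qed
      then show ?thesis unfolding elementary_box_def g_def restrict_def fun_eq_iff by auto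
    qed
    have "inj_on g ?I"
    proof (rule inj_onI)
      fix n n' assume n: "n \<in> ?I" "n' \<in> ?I" and g: "g n = g n'"
      have "n div ?b ^ m = K" "n' div ?b ^ m = K"
        using n by (auto intro!: div_nat_eqI simp: mult.commute)
      then have divs: "n div ?b ^ m = n' div ?b ^ m" by simp
      \<comment> \<open>The difference of the digit vectors lives on the first m positions and is
        annihilated by every stacked row, because equal labels mean equal leading output
        digits.\<close>
      define w where "w r = (of_nat (digit ?b n r) - of_nat (digit ?b n' r) :: 'b mod_ring)" for r
      have w_high: "w r = 0" if "m \<le> r" for r
        using digit_eq_of_div_eq[OF divs that] by (simp add: w_def)
      have "(\<Sum>r<m. M i k r * w r) = 0" if "i < s" "k < d i" for i k
      proof -
        have "radix_prefix ?b (a n i) (d i) = radix_prefix ?b (a n' i) (d i)"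
          using fun_cong[OF g, of i] that by (simp add: g_def)
        then have "digit_image (M i) n k = digit_image (M i) n' k"
          using a_less that(2) by (intro a_inj radix_prefix_inj[of "a n i" ?b "a n' i" "d i" k])
        \<comment> \<open>A common summation range, long enough for the digits of both indices and
          for the first m columns.\<close>
        moreover define L where "L = n + n' + m"
        ultimately have "(\<Sum>r<L. M i k r * of_nat (digit ?b n r)) =
            (\<Sum>r<L. M i k r * of_nat (digit ?b n' r))"
          using digit_image_eq_sum[of n L "M i" k] digit_image_eq_sum[of n' L "M i" k] by simp
        then have "(\<Sum>r<L. M i k r * w r) = 0"
          by (simp add: w_def right_diff_distrib sum_subtractf)
        moreover have "(\<Sum>r<m. M i k r * w r) = (\<Sum>r<L. M i k r * w r)"
          using w_high by (intro sum.mono_neutral_left) (auto simp: L_def)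
        ultimately show ?thesis by simp
      qed
      then have "w r = 0" if "r < m" for r
        using regular[OF d, of w r] that by blast
      then have "digit ?b n r = digit ?b n' r" if "r < m" for r
        using that of_nat_mod_ring_inj[where 'b = 'b] digit_less[OF b(2)] by (simp add: w_def)
      then have "n mod ?b ^ m = n' mod ?b ^ m" by (rule mod_power_eq_of_digit_eq)
      with divs show "n = n'" by (metis div_mult_mod_eq)
    qed
    moreover have "g ` ?I \<subseteq> ?T"
      unfolding g_def using radix_prefix_less[OF a_less]
      by (intro image_subsetI restrict_PiE_iff[THEN iffD2]) simp
    moreover have "card ?T = ?b ^ m"
      by (simp add: card_PiE power_sum flip: d)
    \<comment> \<open>An injection between finite sets of the same size b^m is onto.\<close>
    ultimately have "g ` ?I = ?T"
      using card_I by (intro card_subset_eq) (auto simp: card_image finite_PiE)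
    moreover have "restrict A {..<s} \<in> ?T" using A by (simp only: restrict_PiE_iff) simp
    ultimately have "restrict A {..<s} \<in> g ` ?I" by simp
    then obtain n where "n \<in> ?I" "g n = restrict A {..<s}" by (elim imageE) simp
    then show "\<exists>!n. n \<in> ?I \<and> digital_sequence M n \<in> elementary_box ?b s d A"
      unfolding box using \<open>inj_on g ?I\<close> by (metis inj_onD)
  qed
  show ?thesis unfolding is_0s_sequence_def using cube net by blast
qed

section \<open>Factorization of Sobol' matrices\<close>

definition upper_unitriangular :: "nat \<Rightarrow> 'a::field mat \<Rightarrow> bool" where
  "upper_unitriangular n A \<longleftrightarrow> A \<in> carrier_mat n n \<and>
     (\<forall>u<n. \<forall>v\<le>u. A $$ (u, v) = (if u = v then 1 else 0))"

lemma mat_mult_entry: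
  assumes "A \<in> carrier_mat n m" and "B \<in> carrier_mat m l" and "u < n" and "v < l"
  shows "(A * B) $$ (u, v) = (\<Sum>w<m. A $$ (u, w) * B $$ (w, v))"
  using assms by (auto simp: scalar_prod_def atLeast0LessThan)

lemma upper_unitriangular_one: "upper_unitriangular n (1\<^sub>m n)"
  by (auto simp: upper_unitriangular_def)

lemma upper_unitriangular_mult:
  assumes A: "upper_unitriangular n A" and B: "upper_unitriangular n B"
  shows "upper_unitriangular n (A * B)"
  unfolding upper_unitriangular_def
proof (intro conjI allI impI)
  have carr: "A \<in> carrier_mat n n" "B \<in> carrier_mat n n"
    using A B by (auto simp: upper_unitriangular_def)
  then show "A * B \<in> carrier_mat n n" by simp
  fix u v assume uv: "u < n" "v \<le> u"
  have "(A * B) $$ (u, v) = (\<Sum>w<n. A $$ (u, w) * B $$ (w, v))"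
    using mat_mult_entry[OF carr] uv by simp
  also have "\<dots> = (\<Sum>w<n. if w = u then (if u = v then 1 else 0) else 0)"
  proof (rule sum.cong[OF refl])
    fix w assume "w \<in> {..<n}"
    then show "A $$ (u, w) * B $$ (w, v) = (if w = u then (if u = v then 1 else 0) else 0)"
      using A B uv unfolding upper_unitriangular_def
      by (cases w u rule: linorder_cases) auto
  qed
  also have "\<dots> = (if u = v then 1 else 0)" using uv by simp
  finally show "(A * B) $$ (u, v) = (if u = v then 1 else 0)" .
qed

text \<open>Column by column from the left: in entry (u, v) of \<open>B * A\<close> with v <= u, the
  terms w < v vanish by induction and the terms w > v by triangularity of \<open>A\<close>, which
  leaves \<open>B $$ (u, v)\<close>.\<close>

lemma upper_unitriangular_left_inverse:
  assumes A: "upper_unitriangular n A" and B: "B \<in> carrier_mat n n" and BA: "B * A = 1\<^sub>m n"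
  shows "upper_unitriangular n B"
proof -
  have carr: "A \<in> carrier_mat n n" using A by (auto simp: upper_unitriangular_def)
  have "B $$ (u, v) = (if u = v then 1 else 0)" if "u < n" "v \<le> u" for u v
    using that
  proof (induction v rule: less_induct)
    case (less v)
    have "(if u = v then 1 else 0) = (\<Sum>w<n. B $$ (u, w) * A $$ (w, v))"
      using mat_mult_entry[OF B carr, of u v] less.prems by (simp add: BA)
    also have "\<dots> = (\<Sum>w<n. if w = v then B $$ (u, v) else 0)"
    proof (rule sum.cong[OF refl])
      fix w assume "w \<in> {..<n}"
      then show "B $$ (u, w) * A $$ (w, v) = (if w = v then B $$ (u, v) else 0)"
        using A less.IH[of w] less.prems unfolding upper_unitriangular_def
        by (cases w v rule: linorder_cases) auto
    qed
    also have "\<dots> = B $$ (u, v)" using less.prems by simp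
    finally show ?case by simp
  qed
  then show ?thesis using B by (auto simp: upper_unitriangular_def)
qed

lemma upper_unitriangular_F_mat: "upper_unitriangular (degree p) (F_mat p)"
proof (rule upper_unitriangular_left_inverse)
  show carr: "upper_unitriangular (degree p) (F_inv_mat p)"
    by (auto simp: upper_unitriangular_def F_inv_mat_def)
  show "F_mat p \<in> carrier_mat (degree p) (degree p)" "F_mat p * F_inv_mat p = 1\<^sub>m (degree p)"
    using F_mat[of p] by (simp_all add: F_inv_mat_def)
qed

lemma F_mat_carrier: "F_mat p \<in> carrier_mat (degree p) (degree p)"
  using upper_unitriangular_F_mat[of p] unfolding upper_unitriangular_def by blast

lemma Q_mat_carrier: "Q_mat p \<in> carrier_mat (degree p) (degree p)"
  by (simp add: Q_mat_def)

section \<open>Structure of the block recurrence\<close>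

lemma sobol_block_carrier:
  assumes "M0 \<in> carrier_mat (degree p) (degree p)"
  shows "sobol_block p M0 i j \<in> carrier_mat (degree p) (degree p)"
  using assms by (induction p M0 i j rule: sobol_block.induct)
    (auto intro!: mult_carrier_mat add_carrier_mat F_mat_carrier Q_mat_carrier)

lemma sobol_block_eq_0:
  assumes "j < i"
  shows "sobol_block p M0 i j = 0\<^sub>m (degree p) (degree p)"
  using assms
proof (induction p M0 i j rule: sobol_block.induct)
  case (4 p M0 i j)
  then show ?case using F_mat_carrier[of p] Q_mat_carrier[of p] by simp
qed auto

text \<open>The recurrence multiplies by \<open>Q_mat p\<close> and \<open>F_mat p\<close> only from
  the right, so the initialization factors out on the left.\<close>

lemma sobol_block_mult_init:
  assumes M0: "M0 \<in> carrier_mat (degree p) (degree p)"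
  shows "sobol_block p M0 i j = M0 * sobol_block p (1\<^sub>m (degree p)) i j"
  using assms
proof (induction p M0 i j rule: sobol_block.induct)
  case (4 p M0 i j)
  let ?n = "degree p"
  note carr = F_mat_carrier[of p] Q_mat_carrier[of p] "4.prems"
    sobol_block_carrier[OF one_carrier_mat, of p]
  let ?X = "sobol_block p (1\<^sub>m ?n) (Suc i) (Suc j)" and ?Y = "sobol_block p (1\<^sub>m ?n) i (Suc j)"
  have "M0 * ((?X * Q_mat p + ?Y) * F_mat p) = (M0 * (?X * Q_mat p + ?Y)) * F_mat p"
    using carr
    by (intro assoc_mult_mat[symmetric, of _ ?n ?n _ ?n _ ?n] add_carrier_mat mult_carrier_mat) blast+
  also have "M0 * (?X * Q_mat p + ?Y) = M0 * (?X * Q_mat p) + M0 * ?Y"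
    using carr by (intro mult_add_distrib_mat[of _ ?n ?n _ ?n] mult_carrier_mat) blast+
  also have "M0 * (?X * Q_mat p) = M0 * ?X * Q_mat p"
    using carr by (intro assoc_mult_mat[symmetric, of _ ?n ?n _ ?n _ ?n]) blast+
  finally show ?case using "4.IH" "4.prems" by simp
qed auto

text \<open>On the block diagonal the term with \<open>Q_mat p\<close> involves a zero block from
  below the diagonal, so each diagonal block is the previous one times
  \<open>F_mat p\<close>.\<close>

lemma sobol_block_diag:
  "upper_unitriangular (degree p) (sobol_block p (1\<^sub>m (degree p)) (Suc i) (Suc i))"
proof (induction i)
  case 0
  then show ?case by (simp add: upper_unitriangular_one)
next
  case (Suc i)
  let ?B = "sobol_block p (1\<^sub>m (degree p)) (Suc i) (Suc i)"
  have "sobol_block p (1\<^sub>m (degree p)) (Suc (Suc i)) (Suc (Suc i)) = ?B * F_mat p"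
    using sobol_block_eq_0[of "Suc i" "Suc (Suc i)" p "1\<^sub>m (degree p)"]
      sobol_block_carrier[OF one_carrier_mat, of p "Suc i" "Suc i"] Q_mat_carrier[of p]
    by simp
  then show ?case using upper_unitriangular_mult[OF Suc upper_unitriangular_F_mat] by simp
qed

section \<open>The effect of adding a constant to the polynomial\<close>

lemma sobol_block_entry:
  assumes "M0 \<in> carrier_mat (degree p) (degree p)" and uv: "u < degree p" "v < degree p"
  shows "sobol_block p M0 (Suc i) (Suc (Suc j)) $$ (u, v) =
    (\<Sum>w<degree p. sobol_block p M0 (Suc i) (Suc j) $$ (u, w) * (Q_mat p * F_mat p) $$ (w, v)) +
    (\<Sum>w<degree p. sobol_block p M0 i (Suc j) $$ (u, w) * F_mat p $$ (w, v))"
proof -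
  let ?n = "degree p"
  let ?X = "sobol_block p M0 (Suc i) (Suc j)" and ?Y = "sobol_block p M0 i (Suc j)"
  note carr = F_mat_carrier[of p] Q_mat_carrier[of p] sobol_block_carrier[OF assms(1)]
  have "(?X * Q_mat p + ?Y) * F_mat p = ?X * Q_mat p * F_mat p + ?Y * F_mat p"
    using carr by (intro add_mult_distrib_mat[of _ ?n ?n _ _ ?n] mult_carrier_mat) blast+
  also have "?X * Q_mat p * F_mat p = ?X * (Q_mat p * F_mat p)"
    using carr by (intro assoc_mult_mat[of _ ?n ?n _ ?n _ ?n]) blast+
  finally have *: "sobol_block p M0 (Suc i) (Suc (Suc j)) = ?X * (Q_mat p * F_mat p) + ?Y * F_mat p"
    by simp
  have QF: "Q_mat p * F_mat p \<in> carrier_mat ?n ?n" using carr by auto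
  have "sobol_block p M0 (Suc i) (Suc (Suc j)) $$ (u, v) =
      (?X * (Q_mat p * F_mat p)) $$ (u, v) + (?Y * F_mat p) $$ (u, v)"
    unfolding * using uv carrier_matD[OF carr(1)] carrier_matD[OF carr(3)]
    by (intro index_add_mat) auto
  then show ?thesis
    by (simp only: mat_mult_entry[OF carr(3) QF uv] mat_mult_entry[OF carr(3,1) uv])
qed

text \<open>Above its diagonal \<open>F_inv_mat\<close> contains only coefficients of index between
  1 and e - 1, never the constant one. In degree 0 both matrices are empty.\<close>

lemma F_mat_shift: "F_mat (p + [:c:]) = F_mat p"
proof (cases "degree p = 0")
  case True
  then have "degree (p + [:c:]) = 0" by (metis degree_add_le degree_pCons_0 le_zero_eq order_refl)
  then show ?thesis using True unfolding F_mat_def F_inv_mat_def by (intro arg_cong[of _ _ mat_inv]) auto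
next
  case False
  then have "degree (p + [:c:]) = degree p" by (intro degree_add_eq_left) auto
  then have "F_inv_mat (p + [:c:]) = F_inv_mat p"
    unfolding F_inv_mat_def
    by (intro cong_mat) (auto simp: coeff_pCons split: nat.splits)
  then show ?thesis by (simp add: F_mat_def)
qed

lemma Q_mat_shift:
  assumes "degree p > 0"
  shows "Q_mat (p + [:c:]) = Q_mat p + (- c) \<cdot>\<^sub>m 1\<^sub>m (degree p)"
proof -
  have "degree (p + [:c:]) = degree p" using assms by (intro degree_add_eq_left) auto
  then show ?thesis
    by (intro eq_matI) (auto simp: Q_mat_def coeff_pCons split: nat.splits)
qed

lemma QF_mat_shift_entry:
  assumes deg: "degree p > 0" and uv: "u < degree p" "v < degree p"
  shows "(Q_mat (p + [:c:]) * F_mat (p + [:c:])) $$ (u, v) =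
    (Q_mat p * F_mat p) $$ (u, v) - c * F_mat p $$ (u, v)"
proof -
  let ?n = "degree p"
  note carr = F_mat_carrier[of p] Q_mat_carrier[of p]
  have "Q_mat (p + [:c:]) * F_mat (p + [:c:]) =
      Q_mat p * F_mat p + ((- c) \<cdot>\<^sub>m 1\<^sub>m ?n) * F_mat p"
    unfolding F_mat_shift Q_mat_shift[OF deg]
    using carr by (intro add_mult_distrib_mat[of _ ?n ?n _ _ ?n]) auto
  also have "((- c) \<cdot>\<^sub>m 1\<^sub>m ?n) * F_mat p = (- c) \<cdot>\<^sub>m F_mat p"
    using carr by (simp add: mult_smult_assoc_mat[of _ ?n ?n _ ?n])
  finally show ?thesis using carr uv by simp
qed

text \<open>The substitution of t - c for t, read off at t^i: the weights are the coefficients of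
  the powers (t - c)^k. The sum stops at \<open>j\<close> because the later block rows vanish in
  this block column.\<close>

lemma sobol_block_shift:
  assumes deg: "degree p > 0" and M0: "M0 \<in> carrier_mat (degree p) (degree p)"
    and uv: "u < degree p" "v < degree p"
  shows "sobol_block (p + [:c:]) M0 (Suc i) (Suc j) $$ (u, v) =
    (\<Sum>k\<le>j. shift_coeff (- c) k i * sobol_block p M0 (Suc k) (Suc j) $$ (u, v))"
  using uv
proof (induction j arbitrary: i v)
  case 0
  have "degree (p + [:c:]) = degree p" using deg by (intro degree_add_eq_left) auto
  then show ?case using 0 by (cases i) (simp_all add: shift_coeff_def)
next
  case (Suc j)
  let ?n = "degree p" and ?s = "shift_coeff (- c)"
  have dc: "degree (p + [:c:]) = ?n" using deg by (intro degree_add_eq_left) auto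
  define G where "G w = (Q_mat p * F_mat p) $$ (w, v)" for w
  define F where "F w = F_mat p $$ (w, v)" for w
  define t where "t k w = sobol_block p M0 k (Suc j) $$ (u, w)" for k w
  define t' where "t' k w = sobol_block (p + [:c:]) M0 k (Suc j) $$ (u, w)" for k w
  have QF: "(Q_mat (p + [:c:]) * F_mat p) $$ (w, v) = G w - c * F w" if "w < ?n" for w
    unfolding G_def F_def using QF_mat_shift_entry[OF deg that Suc.prems(2)]
    by (simp only: F_mat_shift)
  have t0: "t 0 w = 0" "t' 0 w = 0" if "w < ?n" for w
    using that Suc.prems sobol_block_eq_0[of 0 "Suc 0"] unfolding t_def t'_def
    by (cases j; simp add: dc)+
  have t_top: "t (Suc (Suc j)) w = 0" if "w < ?n" for w
    unfolding t_def using sobol_block_eq_0[of "Suc j" "Suc (Suc j)" p M0] that Suc.prems by simp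
  have IH: "t' (Suc i) w = (\<Sum>k\<le>j. ?s k i * t (Suc k) w)" if "w < ?n" for i w
    unfolding t_def t'_def using Suc.IH[OF Suc.prems(1) that] .
  \<comment> \<open>Replacing \<open>Q_mat p * F_mat p\<close> by itself minus c times
    \<open>F_mat p\<close> makes this combination the factor of F. The recurrence of
    \<open>shift_coeff\<close> at -c evaluates it; for i = 0 the zero block row supplies its missing
    term.\<close>
  have IH': "t' i w - c * t' (Suc i) w = (\<Sum>k\<le>j. ?s (Suc k) i * t (Suc k) w)" if "w < ?n" for w
    using that
    by (cases i) (simp_all add: t0 IH shift_coeff_Suc sum_distrib_left sum.distrib
        sum_subtractf sum_negf algebra_simps)
  have "sobol_block (p + [:c:]) M0 (Suc i) (Suc (Suc j)) $$ (u, v) =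
      (\<Sum>w<?n. t' (Suc i) w * (G w - c * F w)) + (\<Sum>w<?n. t' i w * F w)"
    using sobol_block_entry[of M0 "p + [:c:]" u v i j] M0 Suc.prems
    by (simp add: dc QF F_mat_shift flip: F_def t'_def)
  also have "\<dots> = (\<Sum>w<?n. t' (Suc i) w * G w) + (\<Sum>w<?n. (t' i w - c * t' (Suc i) w) * F w)"
    by (simp add: algebra_simps sum.distrib sum_subtractf)
  also have "(\<Sum>w<?n. t' (Suc i) w * G w) = (\<Sum>k\<le>j. ?s k i * (\<Sum>w<?n. t (Suc k) w * G w))"
    unfolding sum_distrib_left by (subst sum.swap) (simp add: IH sum_distrib_right mult.assoc)
  \<comment> \<open>The added term k = j + 1 belongs to a block below the diagonal.\<close>
  also have "\<dots> = (\<Sum>k\<le>Suc j. ?s k i * (\<Sum>w<?n. t (Suc k) w * G w))"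
    using t_top by simp
  also have "(\<Sum>w<?n. (t' i w - c * t' (Suc i) w) * F w) =
      (\<Sum>k\<le>j. ?s (Suc k) i * (\<Sum>w<?n. t (Suc k) w * F w))"
    unfolding sum_distrib_left by (subst sum.swap) (simp add: IH' sum_distrib_right mult.assoc)
  \<comment> \<open>After the index shift the added term k = 0 belongs to the zero block row. Both
    sums now carry the same weights, so they combine to the block recurrence of p.\<close>
  also have "\<dots> = (\<Sum>k\<le>Suc j. ?s k i * (\<Sum>w<?n. t k w * F w))"
    using t0 by (subst sum.atMost_Suc_shift) simp
  finally show ?case
    using sobol_block_entry[OF M0 Suc.prems]
    by (simp only: G_def F_def t_def distrib_left sum.distrib)
qed

section \<open>Factorization through the Sobol' matrix with identity initialization\<close>

lemma diagonal_conjugate_entry: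
  fixes D P :: "'a::field mat"
  assumes D: "D \<in> carrier_mat n n" "diagonal_mat D" "invertible_mat D" and P: "P \<in> carrier_mat n n"
    and uv: "u < n" "v < n"
  shows "D $$ (u, u) \<noteq> 0"
    and "(D * P * mat_inv D) $$ (u, v) = D $$ (u, u) * P $$ (u, v) / D $$ (v, v)"
proof -
  note inv = mat_inv[OF D(1,3)]
  have diag: "D $$ (i, j) = 0" if "i < n" "j < n" "i \<noteq> j" for i j
    using that D(1,2) unfolding diagonal_mat_def by auto
  have row: "(D * A) $$ (i, j) = D $$ (i, i) * A $$ (i, j)"
    if "A \<in> carrier_mat n n" "i < n" "j < n" for A i j
  proof -
    have "(D * A) $$ (i, j) = (\<Sum>w<n. D $$ (i, w) * A $$ (w, j))"
      using mat_mult_entry[OF D(1) that] .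
    also have "\<dots> = (\<Sum>w<n. if w = i then D $$ (i, i) * A $$ (i, j) else 0)"
      using that diag by (intro sum.cong) auto
    finally show ?thesis using that by simp
  qed
  have one: "D $$ (i, i) * mat_inv D $$ (i, j) = (if i = j then 1 else 0)" if "i < n" "j < n" for i j
    using row[OF inv(1) that] that by (simp add: inv(2))
  show "D $$ (u, u) \<noteq> 0" using one[OF uv(1,1)] by auto
  have nz: "D $$ (i, i) \<noteq> 0" if "i < n" for i using one[OF that that] by auto
  have entry: "mat_inv D $$ (i, j) = (if i = j then 1 / D $$ (j, j) else 0)" if "i < n" "j < n" for i j
    using one[OF that] nz[OF that(1)] by (auto simp: field_simps)
  have "(D * P * mat_inv D) $$ (u, v) = (\<Sum>w<n. (D * P) $$ (u, w) * mat_inv D $$ (w, v))"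
    using mat_mult_entry[OF _ inv(1) uv] D(1) P by simp
  also have "\<dots> = (\<Sum>w<n. if w = v then D $$ (u, u) * P $$ (u, v) / D $$ (v, v) else 0)"
    using uv entry row[OF P uv(1)] by (intro sum.cong) auto
  finally show "(D * P * mat_inv D) $$ (u, v) = D $$ (u, u) * P $$ (u, v) / D $$ (v, v)"
    using uv by simp
qed

lemma sobol_matrix_one_upper:
  assumes deg: "degree p > 0" and "q \<le> r"
  shows "sobol_matrix p (1\<^sub>m (degree p)) r q = (if r = q then 1 else 0)"
proof -
  let ?n = "degree p"
  have "q div ?n \<le> r div ?n" using assms(2) by (rule div_le_mono)
  then consider "q div ?n < r div ?n" | "q div ?n = r div ?n" by linarith
  then show ?thesis
  proof cases
    case 1
    then show ?thesis using deg sobol_block_eq_0[of "q div ?n + 1" "r div ?n + 1" p "1\<^sub>m ?n"]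
      by (auto simp: sobol_matrix_def Let_def)
  next
    case 2
    then have "q mod ?n \<le> r mod ?n" "q mod ?n = r mod ?n \<longleftrightarrow> q = r"
      using assms(2) by (metis div_mult_mod_eq add_le_cancel_left, metis div_mult_mod_eq)
    then show ?thesis using deg 2 sobol_block_diag[of p "r div ?n"]
      by (auto simp: sobol_matrix_def Let_def upper_unitriangular_def)
  qed
qed

lemma sum_blocks:
  fixes g :: "nat \<Rightarrow> 'a::comm_monoid_add"
  shows "(\<Sum>q<n * J. g q) = (\<Sum>l<J. \<Sum>w<n. g (n * l + w))"
proof -
  have "(\<Sum>q<n * J. g q) = (\<Sum>l<J. sum g {l * n..<l * n + n})"
    by (simp add: sum.nat_group mult.commute)
  moreover have "sum g {l * n..<l * n + n} = (\<Sum>w<n. g (n * l + w))" for l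
    by (rule sum.reindex_bij_witness[of _ "\<lambda>w. n * l + w" "\<lambda>q. q - n * l"]) (auto simp: mult.commute)
  ultimately show ?thesis by simp
qed

text \<open>Block shift weights times entries of the initialization form a Kronecker product, which
  Lucas fuses into one Pascal power; the diagonal \<open>E\<close> collects \<open>D\<close> and the
  alternating signs. The bound \<open>J\<close> may be any number of blocks reaching past column
  \<open>r\<close>, so one \<open>J\<close> can serve many columns at once.\<close>

lemma sobol_matrix_pascal_factorization:
  fixes p :: "'b::prime_card mod_ring poly"
  assumes deg: "degree p = CARD('b)"
    and D: "D \<in> carrier_mat CARD('b) CARD('b)" "diagonal_mat D" "invertible_mat D"
    and r: "r < CARD('b) * J"
  defines "E \<equiv> \<lambda>q. (- 1) ^ (q div CARD('b)) * D $$ (q mod CARD('b), q mod CARD('b))"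
  shows "sobol_matrix (p + [:c:]) (D * pascal_power CARD('b) c * mat_inv D) k r =
    (\<Sum>q<CARD('b) * J. E k * shift_coeff c q k / E q * sobol_matrix p (1\<^sub>m CARD('b)) q r)"
proof -
  let ?b = "CARD('b)"
  let ?M0 = "D * pascal_power ?b c * mat_inv D"
  define N where "N = sobol_block p (1\<^sub>m ?b)"
  have b: "?b > 0" by simp
  have dc: "degree (p + [:c:]) = ?b" using deg by (subst degree_add_eq_left) auto
  have P: "pascal_power ?b c \<in> carrier_mat ?b ?b" by (simp add: pascal_power_def)
  have M0: "?M0 \<in> carrier_mat ?b ?b" using D P mat_inv[OF D(1,3)] by auto
  have carrN: "N i j \<in> carrier_mat ?b ?b" for i j
    using sobol_block_carrier[of "1\<^sub>m ?b" p i j] deg by (simp add: N_def)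
  define i u j v where "i = k div ?b" and "u = k mod ?b" and "j = r div ?b" and "v = r mod ?b"
  have k: "k = ?b * i + u" and uv: "u < ?b" "v < ?b" using b by (simp_all add: i_def u_def v_def)
  have jJ: "Suc j \<le> J" using r by (simp add: j_def less_mult_imp_div_less mult.commute Suc_le_eq)
  have "sobol_matrix (p + [:c:]) ?M0 k r = sobol_block (p + [:c:]) ?M0 (Suc i) (Suc j) $$ (u, v)"
    by (simp add: sobol_matrix_def Let_def dc i_def u_def j_def v_def)
  also have "\<dots> = (\<Sum>l\<le>j. shift_coeff (- c) l i * (?M0 * N (Suc l) (Suc j)) $$ (u, v))"
    using sobol_block_shift[of p ?M0 u v c i j] sobol_block_mult_init[of ?M0 p] M0 uv deg
    by (simp add: N_def)
  also have "\<dots> = (\<Sum>l<J. shift_coeff (- c) l i * (?M0 * N (Suc l) (Suc j)) $$ (u, v))"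
  proof (rule sum.mono_neutral_left)
    show "\<forall>l\<in>{..<J} - {..j}. shift_coeff (- c) l i * (?M0 * N (Suc l) (Suc j)) $$ (u, v) = 0"
    proof
      fix l assume "l \<in> {..<J} - {..j}"
      then have "N (Suc l) (Suc j) = 0\<^sub>m ?b ?b"
        using sobol_block_eq_0[of "Suc j" "Suc l" p "1\<^sub>m ?b"] deg by (simp add: N_def)
      then show "shift_coeff (- c) l i * (?M0 * N (Suc l) (Suc j)) $$ (u, v) = 0"
        using right_mult_zero_mat[OF M0] uv by simp
    qed
  qed (use jJ in auto)
  also have "\<dots> = (\<Sum>l<J. \<Sum>w<?b. shift_coeff (- c) l i * ?M0 $$ (u, w) * N (Suc l) (Suc j) $$ (w, v))"
    by (simp only: mat_mult_entry[OF M0 carrN uv] sum_distrib_left mult.assoc)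
  also have "\<dots> = (\<Sum>l<J. \<Sum>w<?b. E k * shift_coeff c (?b * l + w) k / E (?b * l + w) *
      sobol_matrix p (1\<^sub>m ?b) (?b * l + w) r)"
  proof (intro sum.cong refl)
    fix l w assume "w \<in> {..<?b}"
    then have w: "w < ?b" by simp
    have "?M0 $$ (u, w) = D $$ (u, u) * shift_coeff c w u / D $$ (w, w)"
      using diagonal_conjugate_entry(2)[OF D P uv(1) w] uv(1) w
      by (simp add: pascal_power_def shift_coeff_def)
    moreover have "E k = (- 1) ^ i * D $$ (u, u)" "E (?b * l + w) = (- 1) ^ l * D $$ (w, w)"
      using w by (simp_all add: E_def i_def u_def)
    moreover have "sobol_matrix p (1\<^sub>m ?b) (?b * l + w) r = N (Suc l) (Suc j) $$ (w, v)"
      using w deg by (simp add: sobol_matrix_def Let_def N_def j_def v_def)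
    ultimately show "shift_coeff (- c) l i * ?M0 $$ (u, w) * N (Suc l) (Suc j) $$ (w, v) =
        E k * shift_coeff c (?b * l + w) k / E (?b * l + w) * sobol_matrix p (1\<^sub>m ?b) (?b * l + w) r"
      unfolding k shift_coeff_lucas[OF uv(1) w] shift_coeff_uminus[of c]
      \<comment> \<open>The sign (-1)^l is a factor on one side and a divisor on the other; fixing
        the parity settles this.\<close>
      by (cases "even l") (simp_all add: mult_ac)
  qed
  also have "\<dots> = (\<Sum>q<?b * J. E k * shift_coeff c q k / E q * sobol_matrix p (1\<^sub>m ?b) q r)"
    by (rule sum_blocks[symmetric])
  finally show ?thesis .
qed

section \<open>Kernel vectors as polynomials with prescribed multiple roots\<close>

theorem proposition3:
  fixes p :: "'b::prime_card mod_ring poly"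
    and c :: "nat \<Rightarrow> 'b mod_ring"
    and D :: "'b mod_ring mat"
    and e s :: nat
  assumes "e = CARD('b)"
    and "s \<ge> 1"
    and "degree p = e"
    and "\<And>i. i < s \<Longrightarrow> irreducible (p + [:c i:])"
    and "inj_on (\<lambda>i. p + [:c i:]) {..<s}"
    and "D \<in> carrier_mat e e" and "diagonal_mat D" and "invertible_mat D"
  shows "is_0s_sequence CARD('b) s
           (digital_sequence
             (\<lambda>i. sobol_matrix (p + [:c i:]) (D * pascal_power e (c i) * mat_inv D)))"
proof (rule digital_sequence_is_0s_sequence)
  note deg = assms(3)[unfolded assms(1)] and D = assms(6-8)[unfolded assms(1)]
  let ?b = "CARD('b)"
  let ?M = "\<lambda>i. sobol_matrix (p + [:c i:]) (D * pascal_power e (c i) * mat_inv D)"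
  define N where "N = sobol_matrix p (1\<^sub>m ?b)"
  define E where "E q = (- 1) ^ (q div ?b) * D $$ (q mod ?b, q mod ?b)" for q
  have N: "N q r = (if q = r then 1 else 0)" if "r \<le> q" for q r
    using sobol_matrix_one_upper[of p r q] that deg by (simp add: N_def)
  have E: "E q \<noteq> 0" for q
    using diagonal_conjugate_entry(1)[OF D one_carrier_mat, of "q mod ?b" 0] by (simp add: E_def)
  have M: "?M i k r = (\<Sum>q<?b * J. E k * shift_coeff (c i) q k / E q * N q r)"
    if "r < ?b * J" for i k r J
    unfolding assms(1) N_def E_def by (rule sobol_matrix_pascal_factorization[OF deg D that])
  {
    fix i k r :: nat assume "r < k"
    \<comment> \<open>A product of upper triangular matrices: q < k kills the Pascal entry, and q >=
      k > r kills the entry of \<open>N\<close>.\<close>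
    then have "shift_coeff (c i) q k = 0 \<or> N q r = 0" for q
      using N[of r q] by (cases "q < k") (auto simp: shift_coeff_def binomial_eq_0)
    then have "E k * shift_coeff (c i) q k / E q * N q r = 0" for q by auto
    then have "(\<Sum>q<?b * Suc r. E k * shift_coeff (c i) q k / E q * N q r) = 0"
      by (intro sum.neutral) blast
    moreover have "r < ?b * Suc r"
      using mult_le_mono1[of 1 ?b "Suc r"] by (simp add: Suc_le_eq)
    ultimately show "?M i k r = 0" by (simp only: M)
  }
  fix d :: "nat \<Rightarrow> nat" and m r :: nat and w :: "nat \<Rightarrow> 'b mod_ring"
  assume d: "(\<Sum>i<s. d i) = m" and r: "r < m"
    and ker: "\<And>i k. i < s \<Longrightarrow> k < d i \<Longrightarrow> (\<Sum>r<m. ?M i k r * w r) = 0"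
  \<comment> \<open>With these coefficients, chosen independently of \<open>i\<close>, row
    \<open>k\<close> of the i-th matrix applied to \<open>w\<close> is \<open>E k\<close> times the
    coefficient of x^k in f(x + c_i).\<close>
  define z where "z q = (\<Sum>r<m. N q r * w r) / E q" for q
  define f where "f = (\<Sum>q<m. monom (z q) q)"
  have coeff_f: "coeff f q = (if q < m then z q else 0)" for q
    by (simp add: f_def coeff_sum)
  have m_le: "m \<le> ?b * m" by simp
  have "f = 0"
  proof (rule hermite_interpolation_unique)
    show "finite {..<s}" by simp
    show "inj_on c {..<s}" using assms(5) by (auto simp: inj_on_def)
    show "coeff f l = 0" if "(\<Sum>i<s. d i) \<le> l" for l using that d by (simp add: coeff_f)
    fix i k assume "i \<in> {..<s}" "k < d i"
    then have "0 = (\<Sum>r<m. ?M i k r * w r)" using ker by simp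
    also have "\<dots> = (\<Sum>r<m. (\<Sum>q<?b * m. E k * shift_coeff (c i) q k / E q * N q r) * w r)"
      using m_le by (intro sum.cong refl arg_cong2[of _ _ _ _ "(*)"] M) (meson lessThan_iff less_le_trans)
    also have "\<dots> = (\<Sum>q<?b * m. E k * (shift_coeff (c i) q k * z q))"
      unfolding sum_distrib_right by (subst sum.swap)
        (simp add: z_def sum_distrib_left sum_divide_distrib mult_ac)
    also have "\<dots> = E k * (\<Sum>q<m. shift_coeff (c i) q k * z q)"
      unfolding sum_distrib_left
    \<comment> \<open>The window of m blocks is longer than m; for q >= m > r the entries
      \<open>N q r\<close> are below the diagonal, so \<open>z q\<close> vanishes.\<close>
    proof (rule sum.mono_neutral_right)
      show "\<forall>q\<in>{..<?b * m} - {..<m}. E k * (shift_coeff (c i) q k * z q) = 0"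
        by (auto simp: z_def N)
    qed (use m_le in auto)
    finally have "(\<Sum>q<m. shift_coeff (c i) q k * z q) = 0" using E by simp
    then show "coeff (f \<circ>\<^sub>p [:c i, 1:]) k = 0"
      using coeff_pcompose_shift[of m f "c i" k] by (simp add: coeff_f)
  qed
  then have "z q = 0" if "q < m" for q using coeff_f[of q] that by simp
  then have Nw: "(\<Sum>r<m. N q r * w r) = 0" if "q < m" for q using E that by (auto simp: z_def)
  show "w r = 0"
    using r
  \<comment> \<open>Back substitution from the last row upwards, since \<open>N\<close> is upper
    unitriangular.\<close>
  proof (induction "m - r" arbitrary: r rule: less_induct)
    case less
    have "(\<Sum>r'<m. N r r' * w r') = (\<Sum>r'<m. if r' = r then w r else 0)"
    proof (intro sum.cong refl)
      fix r' assume "r' \<in> {..<m}"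
      then show "N r r' * w r' = (if r' = r then w r else 0)"
        using less.hyps[of r'] less.prems N[of r' r] by (cases r' r rule: linorder_cases) auto
    qed
    then show ?case using Nw[OF less.prems] less.prems by simp
  qed
qed

end
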